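(* For every $\tau$ in the complex upper half-plane, with $q = e^{2\pi i\tau}$, the following two identities hold: $$\frac{1}{\Pi_{q^8}^2}\left(\sum_{n\geq 1}\frac{q^{2n-1}}{(1-q^{2n-1})^2}-8\sum_{n\geq 1}\frac{q^{16n-8}}{(1-q^{16n-8})^2}\right)=\frac{\Pi_{q^4}^3}{\Pi_{q^8}^3}+2\frac{\Pi_{q^4}^2}{\Pi_{q^8}^2}+4\frac{\Pi_{q^4}}{\Pi_{q^8}}+4,$$ and $$\frac{1}{\Pi_{q^8}^2}\left[24\left(\sum_{n\geq 1}\frac{q^{n}}{(1-q^{n})^2}-8\sum_{n\geq 1}\frac{q^{8n}}{(1-q^{8n})^2}\right)+7\right]=7\frac{\Pi_{q^4}^4}{\Pi_{q^8}^4}+24\frac{\Pi_{q^4}^3}{\Pi_{q^8}^3}+72\frac{\Pi_{q^4}^2}{\Pi_{q^8}^2}+96\frac{\Pi_{q^4}}{\Pi_{q^8}}+112.$$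
   Context: For $\tau$ in the complex upper half-plane $\mathbb{H}$, put $q := e^{2\pi i\tau}$ (so $|q|<1$), and for $a\in\mathbb{C}$ let $(a;q)_\infty := \prod_{n=0}^\infty (1-aq^n)$. Gosper's function is $$\Pi_q := q^{1/4}\frac{(q^2;q^2)_\infty^2}{(q;q^2)_\infty^2}.$$ Fractional powers of $q$ are interpreted as $q^{r} = e^{2\pi i r\tau}$. For a positive integer $k$, $\Pi_{q^k}$ is obtained by replacing $q$ with $q^k$ (i.e. $\tau$ with $k\tau$): $\Pi_{q^k} = q^{k/4}\,(q^{2k};q^{2k})_\infty^2/(q^k;q^{2k})_\infty^2$. *)

theory Defs
  imports "HOL-Analysis.Analysis"
begin

text \<open>The infinite $q$-Pochhammer symbol $(a;q)_\infty$, meaningful for $|q| < 1$.\<close>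

definition qpoch_inf :: "complex \<Rightarrow> complex \<Rightarrow> complex" where
  "qpoch_inf a q = (\<Prod>n. 1 - a * q ^ n)"

text \<open>
  $q^r = e^{2\pi i r\tau}$. The argument is $\tau$ rather than $q$, because fractional powers
  of $q$ depend on the choice of $\tau$.
\<close>

definition nome_pow :: "complex \<Rightarrow> real \<Rightarrow> complex" where
  "nome_pow \<tau> r = exp (2 * of_real pi * \<i> * of_real r * \<tau>)"

text \<open>
  Gosper's function $\Pi_q$ as a function of $\tau$; $\Pi_{q^k}$ is its value at $k\tau$.
\<close>

definition gosper_Pi :: "complex \<Rightarrow> complex" where
  "gosper_Pi \<tau> = (let q = nome_pow \<tau> 1 in
     nome_pow \<tau> (1/4) * (qpoch_inf (q^2) (q^2))^2 / (qpoch_inf q (q^2))^2)"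

end

theory Submission
  imports Defs "HOL-Complex_Analysis.Cauchy_Integral_Formula"
begin

text \<open>
  With $\varphi(q) = \sum_{n\in\mathbb{Z}} q^{n^2}$, $\psi(q) = \sum_{n\ge 0} q^{n(n+1)/2}$,
  $X = \varphi(q^4)$ and $Y = q\,\psi(q^8)$ one has $\Pi_{q^4} = XY$ and $\Pi_{q^8} = Y^2$, so both
  identities express combinations of $L(q^k)$, $L(q) = \sum_{n\ge 1} q^n/(1-q^n)^2$, as quartic
  forms in $X$ and $Y$. They reduce to
  $q\,\psi(q^2)^4 = L(q) - 3L(q^2) + 2L(q^4)$ and
  $\varphi(q)^4 + 16q\,\psi(q^2)^4 = 1 + 24(L(q) - 2L(q^2))$.
  Such identities between holomorphic functions are obtained without modular forms: a function
  that is continuous at $0$ and invariant under $q \mapsto q^2$ is constant, and the behaviour of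
  $\varphi$ and $\psi$ under $q \mapsto q^2$ is known from their product forms and from the
  dissection $\varphi(q) = \varphi(q^4) + 2q\,\psi(q^8)$. The Lambert series enter as
  $L(q) = -q E'(q)/E(q)$ for the Euler function $E(q) = (q;q)_\infty$, applied to
  $\varphi(-q)/\varphi(q) = E(q)^4 E(q^4)^2/E(q^2)^6$.
\<close>

section \<open>Euler's function\<close>

definition euler_phi :: "complex \<Rightarrow> complex" where
  "euler_phi q = (\<Prod>n. 1 - q ^ Suc n)"

lemma one_minus_power_nonzero:
  fixes q :: complex
  assumes "norm q < 1" "n > 0"
  shows "1 - q ^ n \<noteq> 0"
proof
  assume "1 - q ^ n = 0"
  hence "norm (q ^ n) = 1" by auto
  with assms show False
    by (metis norm_power norm_ge_zero power_less_one_iff order_less_irrefl)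
qed

lemma convergent_prod_euler:
  fixes a q :: complex
  assumes "norm q < 1"
  shows "convergent_prod (\<lambda>n. 1 - a * q ^ n)"
proof -
  have "summable (\<lambda>n. norm a * norm q ^ n)"
    using assms by (intro summable_mult summable_geometric) auto
  hence "abs_convergent_prod (\<lambda>n. 1 - a * q ^ n)"
    unfolding abs_convergent_prod_conv_summable by (simp add: norm_mult norm_power)
  thus ?thesis by (rule abs_convergent_prod_imp_convergent_prod)
qed

lemma qpoch_inf_LIMSEQ:
  assumes "norm q < 1"
  shows "(\<lambda>N. \<Prod>n<N. 1 - a * q ^ n) \<longlonglongrightarrow> qpoch_inf a q"
  using convergent_prod_LIMSEQ[OF convergent_prod_euler[OF assms, of a]]
  unfolding qpoch_inf_def LIMSEQ_lessThan_iff_atMost[of "prod _"] by simp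

lemma qpoch_inf_nonzero:
  assumes "norm q < 1" "norm a < 1"
  shows "qpoch_inf a q \<noteq> 0"
  unfolding qpoch_inf_def
proof (rule prodinf_nonzero[OF convergent_prod_euler[OF assms(1)]])
  fix n
  have "norm (a * q ^ n) \<le> norm a * 1"
    unfolding norm_mult norm_power using assms
    by (intro mult_left_mono power_le_one) auto
  thus "1 - a * q ^ n \<noteq> 0" using assms by auto
qed

lemma euler_phi_eq_qpoch: "euler_phi q = qpoch_inf q q"
  by (simp add: euler_phi_def qpoch_inf_def)

lemma euler_phi_LIMSEQ:
  assumes "norm q < 1"
  shows "(\<lambda>N. \<Prod>n<N. 1 - q ^ Suc n) \<longlonglongrightarrow> euler_phi q"
  using qpoch_inf_LIMSEQ[OF assms, of q] by (simp add: euler_phi_eq_qpoch)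

lemma euler_phi_nonzero: "norm q < 1 \<Longrightarrow> euler_phi q \<noteq> 0"
  by (simp add: euler_phi_eq_qpoch qpoch_inf_nonzero)

lemma norm_power_less_1:
  fixes q :: complex
  shows "norm q < 1 \<Longrightarrow> k > 0 \<Longrightarrow> norm (q ^ k) < 1"
  by (simp add: norm_power power_less_one_iff)

lemma norm_square_less_1:
  fixes q :: complex
  shows "norm q < 1 \<Longrightarrow> norm (q\<^sup>2) < 1"
  by (rule norm_power_less_1) simp_all

section \<open>Splitting the products by parity and by sign\<close>

lemma prod_even_odd:
  fixes f :: "nat \<Rightarrow> 'a :: comm_monoid_mult"
  shows "(\<Prod>n<2*N. f n) = (\<Prod>n<N. f (2*n)) * (\<Prod>n<N. f (2*n+1))"
  by (induction N) (simp_all add: mult_ac)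

lemma LIMSEQ_double: "f \<longlonglongrightarrow> l \<Longrightarrow> (\<lambda>N::nat. f (2 * N)) \<longlonglongrightarrow> l"
  using LIMSEQ_subseq_LIMSEQ[of f l "\<lambda>N. 2 * N"] by (simp add: strict_mono_def comp_def)

lemma qpoch_inf_odd_even:
  assumes "norm q < 1"
  shows "qpoch_inf a (q\<^sup>2) * qpoch_inf (a * q) (q\<^sup>2) = qpoch_inf a q"
proof (rule LIMSEQ_unique)
  show "(\<lambda>N. \<Prod>n<2*N. 1 - a * q ^ n) \<longlonglongrightarrow> qpoch_inf a q"
    by (rule LIMSEQ_double[OF qpoch_inf_LIMSEQ[OF assms]])
  have "(\<lambda>N. (\<Prod>n<N. 1 - a * (q\<^sup>2) ^ n) * (\<Prod>n<N. 1 - a * q * (q\<^sup>2) ^ n))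
      \<longlonglongrightarrow> qpoch_inf a (q\<^sup>2) * qpoch_inf (a * q) (q\<^sup>2)"
    by (intro tendsto_mult qpoch_inf_LIMSEQ norm_square_less_1 assms)
  thus "(\<lambda>N. \<Prod>n<2*N. 1 - a * q ^ n)
      \<longlonglongrightarrow> qpoch_inf a (q\<^sup>2) * qpoch_inf (a * q) (q\<^sup>2)"
    unfolding prod_even_odd
    by (simp add: power_mult[symmetric] mult_ac)
qed

lemma euler_phi_odd_even:
  assumes "norm q < 1"
  shows "euler_phi q = qpoch_inf q (q\<^sup>2) * euler_phi (q\<^sup>2)"
  using qpoch_inf_odd_even[OF assms, of q] by (simp add: euler_phi_eq_qpoch power2_eq_square)

lemma qpoch_inf_minus:
  assumes "norm q < 1"
  shows "qpoch_inf a q * qpoch_inf (-a) q = qpoch_inf (a\<^sup>2) (q\<^sup>2)"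
proof (rule LIMSEQ_unique)
  show "(\<lambda>N. \<Prod>n<N. 1 - a\<^sup>2 * (q\<^sup>2) ^ n) \<longlonglongrightarrow> qpoch_inf (a\<^sup>2) (q\<^sup>2)"
    by (intro qpoch_inf_LIMSEQ norm_square_less_1 assms)
  have "(\<lambda>N. (\<Prod>n<N. 1 - a * q ^ n) * (\<Prod>n<N. 1 - (-a) * q ^ n))
      \<longlonglongrightarrow> qpoch_inf a q * qpoch_inf (-a) q"
    by (intro tendsto_mult qpoch_inf_LIMSEQ assms)
  moreover have "(1 - a * q ^ n) * (1 - (-a) * q ^ n) = 1 - a\<^sup>2 * (q\<^sup>2) ^ n" for n
    by (simp add: algebra_simps power2_eq_square power_mult_distrib)
  ultimately show "(\<lambda>N. \<Prod>n<N. 1 - a\<^sup>2 * (q\<^sup>2) ^ n) \<longlonglongrightarrow> qpoch_inf a q * qpoch_inf (-a) q"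
    by (simp only: prod.distrib[symmetric])
qed

text \<open>The factors with even exponent agree for q and -q, and the odd ones multiply by (1 -
  x)(1 + x) = 1 - x^2 to the odd part of \<open>euler_phi (q\<^sup>2)\<close>. The product
  identities for the theta functions rest on this relation.\<close>

lemma euler_phi_minus:
  assumes "norm q < 1"
  shows "euler_phi (-q) * euler_phi q * euler_phi (q ^ 4) = euler_phi (q\<^sup>2) ^ 3"
proof -
  let ?O = "\<lambda>q. qpoch_inf q (q\<^sup>2)"
  have q2: "norm (q\<^sup>2) < 1" using assms by (rule norm_square_less_1)
  have "?O q * qpoch_inf (-q) (q\<^sup>2) = ?O (q\<^sup>2)"
    using qpoch_inf_minus[OF q2] by simp
  moreover have "euler_phi q = ?O q * euler_phi (q\<^sup>2)"
    using assms by (rule euler_phi_odd_even)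
  moreover have "euler_phi (-q) = qpoch_inf (-q) (q\<^sup>2) * euler_phi (q\<^sup>2)"
    using euler_phi_odd_even[of "-q"] assms by simp
  moreover have "euler_phi (q\<^sup>2) = ?O (q\<^sup>2) * euler_phi (q ^ 4)"
    using euler_phi_odd_even[OF q2] by (simp flip: power_mult)
  ultimately show ?thesis
    by (simp add: power3_eq_cube mult_ac)
qed

section \<open>Holomorphy and logarithmic derivative of the Euler product\<close>

lemma euler_phi_uniform_limit:
  assumes "0 < r" "r < 1"
  shows "uniform_limit (cball 0 r) (\<lambda>N q. \<Prod>n<N. 1 - q ^ Suc n) euler_phi sequentially"
proof -
  \<comment> \<open>Weierstrass M-test with majorant r^(n+1). The resulting uniform convergence
    serves both holomorphy and termwise logarithmic differentiation.\<close>
  have "uniformly_convergent_on (cball 0 r) (\<lambda>N q::complex. \<Sum>n<N. norm (1 - q ^ Suc n - 1))"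
  proof (rule Weierstrass_m_test')
    show "norm (norm (1 - q ^ Suc n - 1)) \<le> r ^ Suc n" if "q \<in> cball 0 r" for n and q :: complex
      using that power_mono[of "norm q" r "Suc n"] by (simp add: norm_power norm_mult)
    show "summable (\<lambda>n. r ^ Suc n)"
      using assms by (intro summable_Suc_iff[THEN iffD2] summable_geometric) auto
  qed
  hence "uniformly_convergent_on (cball 0 r) (\<lambda>N q::complex. \<Prod>n<N. 1 - q ^ Suc n)"
    by (intro uniformly_convergent_on_prod') (auto intro!: continuous_intros)
  then obtain g where g: "uniform_limit (cball 0 r) (\<lambda>N q::complex. \<Prod>n<N. 1 - q ^ Suc n) g sequentially"
    by (auto simp: uniformly_convergent_on_def)
  have "g q = euler_phi q" if "q \<in> cball 0 r" for q
    using tendsto_uniform_limitI[OF g that] euler_phi_LIMSEQ[of q] that assms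
    by (intro LIMSEQ_unique[of _ "g q"]) auto
  thus ?thesis
    using uniform_limit_cong'[of "cball 0 r" _ _ g euler_phi, OF refl, THEN iffD1, OF _ g] by simp
qed

lemma euler_phi_holomorphic: "euler_phi holomorphic_on ball 0 1"
proof (rule holomorphic_uniform_sequence)
  fix q :: complex assume q: "q \<in> ball 0 1"
  \<comment> \<open>Midway between |q| and 1, so that the disc of radius r - |q| about q stays where
    the convergence is uniform.\<close>
  define r where "r = (1 + norm q) / 2"
  have r: "0 < r" "r < 1" "norm q < r" using q by (auto simp: r_def add_pos_nonneg field_simps)
  have sub: "cball q (r - norm q) \<subseteq> cball 0 r"
  proof
    fix x assume "x \<in> cball q (r - norm q)"
    thus "x \<in> cball 0 r"
      using norm_triangle_ineq[of q "x - q"] by (simp add: dist_norm norm_minus_commute)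
  qed
  show "\<exists>d>0. cball q d \<subseteq> ball 0 1 \<and>
      uniform_limit (cball q d) (\<lambda>N q. \<Prod>n<N. 1 - q ^ Suc n) euler_phi sequentially"
  proof (intro exI[of _ "r - norm q"] conjI)
    show "cball q (r - norm q) \<subseteq> ball 0 1" using sub r by fastforce
    show "uniform_limit (cball q (r - norm q)) (\<lambda>N q. \<Prod>n<N. 1 - q ^ Suc n) euler_phi sequentially"
      using euler_phi_uniform_limit[OF r(1,2)] sub by (rule uniform_limit_on_subset)
  qed (use r in auto)
qed (auto intro!: holomorphic_intros)

lemma euler_phi_logderiv_sums:
  assumes "norm q < 1"
  shows "(\<lambda>n. of_nat (Suc n) * q ^ Suc n / (1 - q ^ Suc n)) sums
      - (q * deriv euler_phi q / euler_phi q)"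
proof -
  define r where "r = (1 + norm q) / 2"
  have r: "0 < r" "r < 1" "norm q < r" using assms by (auto simp: r_def add_pos_nonneg field_simps)
  have "(\<lambda>n. deriv (\<lambda>q. 1 - q ^ Suc n) q / (1 - q ^ Suc n)) sums (deriv euler_phi q / euler_phi q)"
  proof (rule logderiv_prodinf_complex_uniform_limit[where A = "ball 0 r"])
    show "uniform_limit (ball 0 r) (\<lambda>N q. \<Prod>n<N. 1 - q ^ Suc n) euler_phi sequentially"
      using euler_phi_uniform_limit[OF r(1,2)] by (rule uniform_limit_on_subset) auto
  qed (use r assms in \<open>auto intro!: holomorphic_intros euler_phi_nonzero\<close>)
  moreover have "deriv (\<lambda>q. 1 - q ^ Suc n) q = - (of_nat (Suc n) * q ^ n)" for n
    by (rule DERIV_imp_deriv) (rule derivative_eq_intros refl | simp)+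
  ultimately have "(\<lambda>n. (- q) * (- (of_nat (Suc n) * q ^ n) / (1 - q ^ Suc n)))
      sums ((- q) * (deriv euler_phi q / euler_phi q))"
    by (intro sums_mult) simp
  thus ?thesis by (simp add: mult_ac)
qed

section \<open>The Lambert series as a logarithmic derivative\<close>

text \<open>For |q| < 1 this is the generating function of the divisor sum sigma(n), so 1 - 24
  \<open>lambert q\<close> is the Eisenstein series E_2.\<close>

definition lambert :: "complex \<Rightarrow> complex" where
  "lambert q = (\<Sum>\<^sub>\<infinity>n\<in>{1..}. q ^ n / (1 - q ^ n)\<^sup>2)"

lemma bij_betw_Suc_atLeast_1: "bij_betw Suc UNIV {1..}"
  by (auto simp: bij_betw_def image_iff Suc_le_eq gr0_conv_Suc)

lemma has_sum_atLeast_1_iff: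
  fixes f :: "nat \<Rightarrow> 'a :: {comm_monoid_add, topological_space}"
  shows "(f has_sum s) {1..} \<longleftrightarrow> ((\<lambda>n. f (Suc n)) has_sum s) UNIV"
  by (rule has_sum_reindex_bij_betw[OF bij_betw_Suc_atLeast_1, symmetric])

lemma geometric_has_sum:
  fixes x :: "'a :: {real_normed_field, banach}"
  assumes "norm x < 1"
  shows "((\<lambda>m. x ^ m) has_sum (x / (1 - x))) {1..}"
  unfolding has_sum_atLeast_1_iff
proof (rule norm_summable_imp_has_sum)
  show "summable (\<lambda>n. norm (x ^ Suc n))"
    using assms summable_Suc_iff[of "\<lambda>n. norm x ^ n"] summable_geometric[of "norm x"]
    by (simp add: norm_power norm_mult)
  show "(\<lambda>n. x ^ Suc n) sums (x / (1 - x))"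
    using sums_mult[OF geometric_sums[OF assms], of x] by simp
qed

lemma summable_nat_times_power:
  fixes r :: real
  assumes "0 \<le> r" "r < 1"
  shows "summable (\<lambda>n. real (Suc n) * r ^ Suc n)"
  using sums_summable[OF sums_mult[OF geometric_deriv_sums[of r], of r]] assms
  by (simp add: mult_ac)

lemma geometric_deriv_has_sum:
  fixes x :: complex
  assumes "norm x < 1"
  shows "((\<lambda>n. of_nat n * x ^ n) has_sum (x / (1 - x)\<^sup>2)) {1..}"
  unfolding has_sum_atLeast_1_iff
proof (rule norm_summable_imp_has_sum)
  show "summable (\<lambda>n. norm (of_nat (Suc n) * x ^ Suc n))"
    using summable_nat_times_power[of "norm x"] assms
    by (simp only: norm_mult norm_power norm_of_nat norm_ge_zero)
  show "(\<lambda>n. of_nat (Suc n) * x ^ Suc n) sums (x / (1 - x)\<^sup>2)"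
    using sums_mult[OF geometric_deriv_sums[OF assms], of x] by (simp add: mult_ac)
qed

text \<open>With r = |q|, the norms for fixed n sum over m to n r^n / (1 - r^n), at most n r^n / (1
  - r), which is summable in n. This justifies the exchanges of summation below.\<close>

lemma lambert_double_summable:
  fixes q :: complex
  assumes "norm q < 1"
  shows "(\<lambda>(n, m). of_nat n * q ^ (n * m)) summable_on {1..} \<times> {1::nat..}"
proof (rule abs_summable_summable)
  define r where "r = norm q"
  have r: "0 \<le> r" "r < 1" using assms by (auto simp: r_def)
  have rn: "r ^ n < 1" if "n \<ge> 1" for n
    using r that by (simp add: power_less_one_iff)
  have geo: "((\<lambda>m. real n * (r ^ n) ^ m) has_sum (real n * (r ^ n / (1 - r ^ n)))) {1..}"
    if n: "n \<ge> 1" for n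
  proof -
    have "((\<lambda>m. (r ^ n) ^ m) has_sum (r ^ n / (1 - r ^ n))) {1..}"
      using rn[OF n] r by (intro geometric_has_sum) (simp add: power_abs)
    thus ?thesis by (rule has_sum_cmult_right)
  qed
  have norm_eq: "norm (of_nat n * q ^ (n * m)) = real n * (r ^ n) ^ m" for n m
    by (simp add: norm_mult norm_power r_def power_mult)
  have "(\<lambda>n. norm (real n * (r ^ n / (1 - r ^ n)))) summable_on {1..}"
  proof (rule Infinite_Sum.abs_summable_on_comparison_test)
    have "(\<lambda>n. norm (real (Suc n) * r ^ Suc n * (1 / (1 - r)))) summable_on UNIV"
      using summable_mult2[OF summable_nat_times_power[OF r], of "1 / (1 - r)"] r
      by (intro norm_summable_imp_summable_on) (simp add: abs_mult)
    thus "(\<lambda>n. norm (real n * r ^ n * (1 / (1 - r)))) summable_on {1..}"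
      using summable_on_reindex_bij_betw[OF bij_betw_Suc_atLeast_1,
          of "\<lambda>n. norm (real n * r ^ n * (1 / (1 - r)))"] by simp
  next
    fix n :: nat assume n: "n \<in> {1..}"
    have "r ^ n \<le> r" using power_decreasing[of 1 n r] n r by simp
    hence "1 / (1 - r ^ n) \<le> 1 / (1 - r)" using r rn[of n] n by (intro divide_left_mono) auto
    hence "real n * r ^ n * (1 / (1 - r ^ n)) \<le> real n * r ^ n * (1 / (1 - r))"
      using r by (intro mult_left_mono) auto
    thus "norm (real n * (r ^ n / (1 - r ^ n))) \<le> norm (real n * r ^ n * (1 / (1 - r)))"
      using r rn[of n] n by (simp add: abs_mult)
  qed
  moreover have "infsum (\<lambda>m. norm (of_nat n * q ^ (n * m))) {1..} = real n * (r ^ n / (1 - r ^ n))"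
    if "n \<in> {1..}" for n
    unfolding norm_eq using that by (intro infsumI geo) auto
  moreover have "(\<lambda>m. norm (of_nat n * q ^ (n * m))) summable_on {1..}" if "n \<in> {1..}" for n
    unfolding norm_eq using that by (intro has_sum_imp_summable[OF geo]) auto
  ultimately show "(\<lambda>x. norm (case x of (n, m) \<Rightarrow> of_nat n * q ^ (n * m))) summable_on {1..} \<times> {1::nat..}"
    unfolding Infinite_Sum.abs_summable_on_Sigma_iff prod.case
    by (metis (mono_tags, lifting) summable_on_cong)
qed

text \<open>Summing the double family over n first leaves exactly this term in m. Since
  \<open>infsum\<close> is 0 on families that are not summable, splitting the series by parity
  relies on it.\<close>

lemma lambert_summable:
  fixes q :: complex
  assumes "norm q < 1"
  shows "(\<lambda>n. q ^ n / (1 - q ^ n)\<^sup>2) summable_on {1..}"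
proof -
  have "((\<lambda>(n, m). of_nat n * q ^ (n * m)) \<circ> prod.swap) summable_on {1..} \<times> {1..}"
    using lambert_double_summable[OF assms]
    by (subst summable_on_reindex[symmetric]) (auto simp: product_swap)
  hence "(\<lambda>(m, n). of_nat n * q ^ (n * m)) summable_on {1..} \<times> {1..}"
    by (simp add: comp_def case_prod_unfold)
  hence "(\<lambda>m. \<Sum>\<^sub>\<infinity>n\<in>{1..}. of_nat n * q ^ (n * m)) summable_on {1..}"
    by (rule summable_on_Sigma_banach)
  moreover have "(\<Sum>\<^sub>\<infinity>n\<in>{1..}. of_nat n * q ^ (n * m)) = q ^ m / (1 - q ^ m)\<^sup>2" if "m \<in> {1..}" for m
    using geometric_deriv_has_sum[of "q ^ m"] that assms
    by (intro infsumI) (simp add: norm_power power_less_one_iff power_mult[symmetric] mult.commute)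
  ultimately show ?thesis by (rule summable_on_cong[THEN iffD1, rotated])
qed

text \<open>The family n q^(nm) gives q^m / (1 - q^m)^2 when summed over n first, and n q^n / (1 -
  q^n) when summed over m first; the latter is the termwise logarithmic derivative of the Euler
  product.\<close>

lemma lambert_eq_logderiv:
  assumes "norm q < 1"
  shows "lambert q = - (q * deriv euler_phi q / euler_phi q)"
proof -
  define f where "f = (\<lambda>n. of_nat n * q ^ n / (1 - q ^ n))"
  have inner: "((\<lambda>m. of_nat n * q ^ (n * m)) has_sum f n) {1..}" if "n \<in> {1..}" for n
    using has_sum_cmult_right[OF geometric_has_sum[of "q ^ n"], of "of_nat n"] that assms
    by (simp add: f_def norm_power power_less_one_iff power_mult)
  have "(\<Sum>\<^sub>\<infinity>n\<in>{1..}. \<Sum>\<^sub>\<infinity>m\<in>{1..}. of_nat n * q ^ (n * m)) =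
        (\<Sum>\<^sub>\<infinity>m\<in>{1..}. \<Sum>\<^sub>\<infinity>n\<in>{1..}. of_nat n * q ^ (n * m))"
    by (rule infsum_swap_banach[OF lambert_double_summable[OF assms]])
  also have "\<dots> = lambert q"
    unfolding lambert_def
  proof (rule infsum_cong)
    fix m :: nat assume "m \<in> {1..}"
    thus "(\<Sum>\<^sub>\<infinity>n\<in>{1..}. of_nat n * q ^ (n * m)) = q ^ m / (1 - q ^ m)\<^sup>2"
      using geometric_deriv_has_sum[of "q ^ m"] assms
      by (intro infsumI) (simp add: norm_power power_less_one_iff power_mult[symmetric] mult.commute)
  qed
  also have "(\<Sum>\<^sub>\<infinity>n\<in>{1..}. \<Sum>\<^sub>\<infinity>m\<in>{1..}. of_nat n * q ^ (n * m)) = infsum f {1..}"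
    by (intro infsum_cong infsumI inner)
  finally have eq: "lambert q = infsum f {1..}" ..
  have "(\<lambda>n. \<Sum>\<^sub>\<infinity>m\<in>{1..}. of_nat n * q ^ (n * m)) summable_on {1..}"
    by (rule summable_on_Sigma_banach[OF lambert_double_summable[OF assms]])
  hence "f summable_on {1..}"
    by (subst (asm) summable_on_cong[OF infsumI[OF inner]])
  hence "(f has_sum lambert q) {1..}"
    unfolding eq by (rule has_sum_infsum)
  hence "(\<lambda>n. f (Suc n)) sums lambert q"
    unfolding has_sum_atLeast_1_iff by (rule has_sum_imp_sums)
  moreover have "(\<lambda>n. f (Suc n)) sums - (q * deriv euler_phi q / euler_phi q)"
    unfolding f_def by (rule euler_phi_logderiv_sums[OF assms])
  ultimately show ?thesis by (rule sums_unique2)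
qed

lemma lambert_odd:
  assumes "norm q < 1"
  shows "(\<Sum>\<^sub>\<infinity>n\<in>{1..}. q ^ (2*n - 1) / (1 - q ^ (2*n - 1))\<^sup>2) = lambert q - lambert (q\<^sup>2)"
proof -
  define f where "f = (\<lambda>n. q ^ n / (1 - q ^ n)\<^sup>2)"
  define A where "A = (\<lambda>n::nat. 2 * n - 1) ` {1..}"
  define B where "B = (\<lambda>n::nat. 2 * n) ` {1..}"
  have "n \<in> A \<union> B" if "n \<ge> 1" for n
  proof (cases "even n")
    case True
    with that show ?thesis by (auto simp: B_def elim!: evenE)
  next
    case False
    then obtain k where "n = 2 * k + 1" by (elim oddE)
    \<comment> \<open>The odd numbers are parametrised from 1, so 2k + 1 is reached at k +
      1.\<close>
    hence "n = 2 * Suc k - 1" by simp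
    hence "n \<in> A" unfolding A_def by (rule image_eqI) simp
    thus ?thesis ..
  qed
  hence AB: "A \<union> B = {1..}" by (auto simp: A_def B_def)
  have "A \<inter> B = {}" by (auto simp: A_def B_def) presburger
  have summ: "f summable_on {1..}" unfolding f_def by (rule lambert_summable[OF assms])
  have "lambert q = infsum f (A \<union> B)" by (simp add: AB f_def lambert_def)
  also have "\<dots> = infsum f A + infsum f B"
    by (intro infsum_Un_disjoint \<open>A \<inter> B = {}\<close> summable_on_subset_banach[OF summ])
       (use AB in auto)
  also have "infsum f A = (\<Sum>\<^sub>\<infinity>n\<in>{1..}. f (2 * n - 1))"
    unfolding A_def by (subst infsum_reindex) (auto simp: inj_on_def comp_def)
  also have "infsum f B = (\<Sum>\<^sub>\<infinity>n\<in>{1..}. f (2 * n))"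
    unfolding B_def by (subst infsum_reindex) (auto simp: inj_on_def comp_def)
  also have "\<dots> = lambert (q\<^sup>2)"
    by (simp add: lambert_def f_def power_mult)
  finally show ?thesis by (simp add: f_def)
qed

section \<open>Ramanujan's theta functions\<close>

text \<open>
  These are Gauss's product forms of $\sum_{n\in\mathbb{Z}} q^{n^2}$ and
  $\sum_{n\ge 0} q^{n(n+1)/2}$.
\<close>

definition theta_phi :: "complex \<Rightarrow> complex" where
  "theta_phi q = (euler_phi (-q))\<^sup>2 / euler_phi (q\<^sup>2)"

definition theta_psi :: "complex \<Rightarrow> complex" where
  "theta_psi q = (euler_phi (q\<^sup>2))\<^sup>2 / euler_phi q"

lemma one_plus_power_nonzero:
  fixes q :: complex
  assumes "norm q < 1"
  shows "1 + q ^ n \<noteq> 0"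
proof (cases "n = 0")
  case False
  have "(1 - q ^ n) * (1 + q ^ n) = 1 - q ^ (2 * n)"
    by (simp add: algebra_simps flip: power_add mult_2)
  thus ?thesis using one_minus_power_nonzero[OF assms, of "2 * n"] False by auto
qed auto

text \<open>
  Finite forms of Gauss's series, after Shanks. On the right-hand side only the term $s = 0$
  survives as $n \to\infty$. In both inductive steps the difference of consecutive terms
  telescopes in $s$.
\<close>

lemma shanks_phi:
  fixes q :: complex
  assumes q: "norm q < 1"
  defines "R \<equiv> \<lambda>n. \<Prod>k<n. (1 - q ^ Suc k) / (1 + q ^ Suc k)"
  shows "1 + 2 * (\<Sum>s<n. (-1) ^ Suc s * q ^ (Suc s)\<^sup>2) =
    (\<Sum>s\<le>n. (-1) ^ s * (2 / (1 + q ^ s)) * q ^ (s * Suc n) * (R n / R s))"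
proof (induction n)
  case (Suc n)
  define t where "t = (\<lambda>n s. (-1) ^ s * (2 / (1 + q ^ s)) * q ^ (s * Suc n) * (R n / R s))"
  define b where "b = q ^ Suc n"
  have nz: "1 + q ^ s \<noteq> 0" "1 - q ^ Suc s \<noteq> 0" for s
    using one_plus_power_nonzero[OF q] one_minus_power_nonzero[OF q, of "Suc s"] by auto
  have R_Suc: "R (Suc m) = R m * ((1 - q ^ Suc m) / (1 + q ^ Suc m))" for m
    by (simp add: R_def)
  have R_nz: "R m \<noteq> 0" for m
    unfolding R_def using nz by (subst prod_zero_iff) (auto simp del: power_Suc)
  \<comment> \<open>The telescoping potential: \<open>t (Suc n) s - t n s\<close> is the increment
    of \<open>v\<close> at s divided by 1 + b. The factor 1 - q^s makes \<open>v 0\<close>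
    vanish.\<close>
  define v where "v = (\<lambda>s. t n s * (1 - q ^ s))"
  have b: "1 + b \<noteq> 0" "1 - b \<noteq> 0" unfolding b_def by (rule nz)+
  have v_Suc: "v (Suc s) = - t n s * (1 + q ^ s) * b" for s
  proof -
    have cancel: "- e * (2 / (1 + x)) * (b * y) * (r / (u * ((1 - x) / (1 + x)))) * (1 - x) =
        - (e * (2 / (1 + a)) * y * (r / u)) * (1 + a) * b"
      if "1 + x \<noteq> 0" "1 - x \<noteq> 0" "1 + a \<noteq> 0" for a b e x y r u :: complex
      using that by simp
    have pow: "q ^ (Suc s * Suc n) = b * q ^ (s * Suc n)" "(-1 :: complex) ^ Suc s = - ((-1) ^ s)"
      by (simp_all add: b_def power_add)
    show ?thesis
      unfolding v_def t_def R_Suc pow by (rule cancel[OF nz nz(1)])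
  qed
  have diff: "t (Suc n) s - t n s = (v (Suc s) - v s) / (1 + b)" for s
  proof -
    have "t (Suc n) s = t n s * q ^ s * ((1 - b) / (1 + b))"
      by (simp add: t_def R_Suc b_def power_add mult_ac)
    hence "t (Suc n) s - t n s = (t n s * q ^ s * (1 - b) - t n s * (1 + b)) / (1 + b)"
      using b by (simp add: field_simps)
    thus ?thesis unfolding v_Suc unfolding v_def by (simp add: algebra_simps)
  qed
  have "(\<Sum>s\<le>n. t (Suc n) s) - (\<Sum>s\<le>n. t n s) = (v (Suc n) - v 0) / (1 + b)"
    unfolding sum_subtractf[symmetric] diff sum_divide_distrib[symmetric]
    using sum_telescope[of "\<lambda>s. - v s" n] by (simp add: algebra_simps)
  also have "v 0 = 0" by (simp add: v_def)
  also have "v (Suc n) = 2 * (-1) ^ Suc n * q ^ (Suc n)\<^sup>2"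
  proof -
    have cancel: "e * (2 / (1 + b)) * y * (r / (r * ((1 - b) / (1 + b)))) * (1 - b) = 2 * e * y"
      if "1 + b \<noteq> 0" "1 - b \<noteq> 0" "r \<noteq> 0" for b e y r :: complex
      using that by simp
    show ?thesis
      unfolding v_def t_def R_Suc power2_eq_square b_def[symmetric] by (rule cancel[OF b R_nz])
  qed
  finally have 1: "(\<Sum>s\<le>n. t (Suc n) s) =
      (\<Sum>s\<le>n. t n s) + 2 * (-1) ^ Suc n * q ^ (Suc n)\<^sup>2 / (1 + b)"
    by (simp add: algebra_simps)
  have "q ^ (Suc n * Suc (Suc n)) = q ^ (Suc n)\<^sup>2 * b"
    by (simp add: power2_eq_square b_def algebra_simps flip: power_add)
  hence 2: "t (Suc n) (Suc n) = 2 * (-1) ^ Suc n * q ^ (Suc n)\<^sup>2 * b / (1 + b)"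
    using R_nz[of "Suc n"] unfolding t_def b_def[symmetric] by (simp del: power_Suc mult_Suc mult_Suc_right)
  \<comment> \<open>With c = 2 (-1)^(n+1) q^((n+1)^2), the telescoped boundary c / (1 + b) and the
    new summand c b / (1 + b) add up to c, the next term of the series.\<close>
  have "(\<Sum>s\<le>Suc n. t (Suc n) s) = (\<Sum>s\<le>n. t n s) + 2 * (-1) ^ Suc n * q ^ (Suc n)\<^sup>2"
    unfolding sum.atMost_Suc 1 2 using b by (simp add: divide_simps) (simp add: algebra_simps)
  thus ?case using Suc.IH unfolding t_def by (simp add: algebra_simps)
qed (simp add: R_def)

lemma shanks_psi:
  fixes q :: complex
  assumes q: "norm q < 1"
  defines "P \<equiv> \<lambda>n. \<Prod>k<n. (1 - q ^ (2 * k + 2)) / (1 - q ^ (2 * k + 1))"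
  shows "(\<Sum>s<2 * n. q ^ (s * (s + 1) div 2)) = (\<Sum>s<n. q ^ (s * (2 * n + 1)) * (P n / P s))"
proof (induction n)
  case (Suc n)
  define t where "t = (\<lambda>n s. q ^ (s * (2 * n + 1)) * (P n / P s))"
  define b where "b = q ^ (2 * n + 1)"
  have nz: "1 - q ^ (2 * s + 1) \<noteq> 0" "1 - q ^ (2 * s + 2) \<noteq> 0" for s
    using one_minus_power_nonzero[OF q, of "2 * s + 1"] one_minus_power_nonzero[OF q, of "2 * s + 2"]
    by simp_all
  have P_Suc: "P (Suc m) = P m * ((1 - q ^ (2 * m + 2)) / (1 - q ^ (2 * m + 1)))" for m
    by (simp add: P_def)
  have P_nz: "P m \<noteq> 0" for m
    unfolding P_def using nz by (subst prod_zero_iff) (auto simp del: power_Suc)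
  \<comment> \<open>The potential again, now with 1 - q^(2s) vanishing at s = 0 and with increments
    divided by 1 - b.\<close>
  define v where "v = (\<lambda>s. t n s * (1 - q ^ (2 * s)))"
  have b: "1 - b \<noteq> 0" unfolding b_def by (rule nz)
  have qb: "q ^ (2 * n + 2) = q * b" by (simp add: b_def)
  have v_Suc: "v (Suc s) = t n s * (1 - q ^ (2 * s + 1)) * b" for s
  proof -
    have cancel: "b * y * (r / (u * ((1 - x) / (1 - z)))) * (1 - x) = y * (r / u) * (1 - z) * b"
      if "1 - x \<noteq> 0" for b x y z r u :: complex
      using that by simp
    have pow: "q ^ (Suc s * (2 * n + 1)) = b * q ^ (s * (2 * n + 1))" "2 * Suc s = 2 * s + 2"
      by (simp_all add: b_def power_add)
    show ?thesis
      unfolding v_def t_def P_Suc pow by (rule cancel[OF nz(2)])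
  qed
  have diff: "t (Suc n) s - t n s = (v (Suc s) - v s) / (1 - b)" for s
  proof -
    have "q ^ (s * (2 * Suc n + 1)) = q ^ (s * (2 * n + 1)) * q ^ (2 * s)"
      by (simp add: algebra_simps flip: power_add)
    note pow = this qb
    have "t (Suc n) s = t n s * q ^ (2 * s) * ((1 - q * b) / (1 - b))"
      unfolding t_def P_Suc pow b_def[symmetric] by (simp add: mult_ac)
    hence "t (Suc n) s - t n s = (t n s * q ^ (2 * s) * (1 - q * b) - t n s * (1 - b)) / (1 - b)"
      using b by (simp add: field_simps)
    thus ?thesis unfolding v_Suc unfolding v_def by (simp add: algebra_simps)
  qed
  have "(\<Sum>s<n. t (Suc n) s) - (\<Sum>s<n. t n s) = (v n - v 0) / (1 - b)"
    unfolding sum_subtractf[symmetric] diff sum_divide_distrib[symmetric]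
    by (simp only: sum_lessThan_telescope)
  also have "v 0 = 0" by (simp add: v_def)
  also have "v n = q ^ (n * (2 * n + 1)) * (1 - q ^ (2 * n))"
    using P_nz[of n] by (simp add: v_def t_def)
  finally have 1: "(\<Sum>s<n. t (Suc n) s) =
      (\<Sum>s<n. t n s) + q ^ (n * (2 * n + 1)) * (1 - q ^ (2 * n)) / (1 - b)"
    by (simp add: algebra_simps)
  have "q ^ (n * (2 * Suc n + 1)) = q ^ (n * (2 * n + 1)) * q ^ (2 * n)"
    by (simp add: algebra_simps flip: power_add)
  note pow = this qb
  have 2: "t (Suc n) n = q ^ (n * (2 * n + 1)) * q ^ (2 * n) * (1 - q * b) / (1 - b)"
    using P_nz[of n] unfolding t_def P_Suc pow b_def[symmetric] by simp
  have 3: "q * q ^ (2 * n) = b" by (simp add: b_def)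
  \<comment> \<open>The boundary value and the new summand s = n combine to the numerator 1 - b^2,
    because q q^(2n) = b. The remaining 1 + b supplies the triangular exponents for s = 2n and s =
    2n + 1.\<close>
  have "(\<Sum>s<Suc n. t (Suc n) s) =
      (\<Sum>s<n. t n s) + q ^ (n * (2 * n + 1)) * (1 - q * q ^ (2 * n) * b) / (1 - b)"
    unfolding sum.lessThan_Suc 1 2 using b by (simp add: divide_simps) (simp add: algebra_simps)
  also have "q ^ (n * (2 * n + 1)) * (1 - q * q ^ (2 * n) * b) / (1 - b) =
      q ^ (n * (2 * n + 1)) * (1 + b)"
    unfolding 3 using b by (simp add: divide_simps) (simp add: algebra_simps)
  also have "\<dots> = q ^ (2 * n * (2 * n + 1) div 2) + q ^ ((2 * n + 1) * (2 * n + 2) div 2)"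
  proof -
    have "(2 * n + 1) * (2 * n + 2) div 2 = n * (2 * n + 1) + (2 * n + 1)"
      by (simp add: algebra_simps)
    moreover have "2 * n * (2 * n + 1) div 2 = n * (2 * n + 1)"
      by (simp add: algebra_simps)
    ultimately show ?thesis unfolding b_def by (simp only: power_add) (simp add: algebra_simps)
  qed
  finally show ?case using Suc.IH unfolding t_def by (simp add: algebra_simps)
qed simp

section \<open>From the finite identities to the theta series\<close>

lemma tendsto_sum_dominated_by_first:
  fixes f :: "nat \<Rightarrow> nat \<Rightarrow> complex"
  assumes first: "(\<lambda>n. f n 0) \<longlonglongrightarrow> L"
    and bound: "\<And>n s. 1 \<le> s \<Longrightarrow> s \<le> n \<Longrightarrow> norm (f n s) \<le> C * r ^ n"
    and r: "0 \<le> r" "r < 1"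
  shows "(\<lambda>n. \<Sum>s\<le>n. f n s) \<longlonglongrightarrow> L"
proof -
  \<comment> \<open>The n terms after the first total at most C n r^n.\<close>
  have "(\<lambda>n. C * (of_nat n * r ^ n)) \<longlonglongrightarrow> C * 0"
    using r by (intro tendsto_mult tendsto_const powser_times_n_limit_0) simp
  hence lim: "(\<lambda>n. C * (of_nat n * r ^ n)) \<longlonglongrightarrow> 0" by simp
  have bnd: "norm (\<Sum>s=1..n. f n s) \<le> C * (of_nat n * r ^ n)" for n
  proof -
    have "norm (\<Sum>s=1..n. f n s) \<le> (\<Sum>s=1..n. C * r ^ n)"
      by (rule sum_norm_le) (use bound in auto)
    thus ?thesis by (simp add: mult_ac)
  qed
  have "(\<lambda>n. \<Sum>s=1..n. f n s) \<longlonglongrightarrow> 0"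
    by (rule Lim_null_comparison[OF always_eventually lim]) (use bnd in blast)
  from tendsto_add[OF first this] show ?thesis
    by (simp add: atMost_atLeast0 sum.atLeast_Suc_atMost)
qed

text \<open>A nonzero limit bounds both \<open>R\<close> and its inverse, hence the quotients
  uniformly in both indices. This controls the factors \<open>R n / R s\<close> in Shanks's
  sums.\<close>

lemma bounded_quotients:
  fixes R :: "nat \<Rightarrow> complex"
  assumes "R \<longlonglongrightarrow> L" "L \<noteq> 0"
  obtains C where "\<And>n s. norm (R n / R s) \<le> C"
proof -
  have "Bseq R" using assms(1) by (intro convergent_imp_Bseq convergentI)
  then obtain A where A: "A > 0" "\<And>n. norm (R n) \<le> A" by (auto simp: Bseq_def)
  have "Bseq (\<lambda>n. inverse (R n))"
    using tendsto_inverse[OF assms] by (intro convergent_imp_Bseq convergentI)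
  then obtain B where B: "B > 0" "\<And>n. norm (inverse (R n)) \<le> B" by (auto simp: Bseq_def)
  have "norm (R n / R s) \<le> A * B" for n s
    unfolding divide_inverse norm_mult using A B by (intro mult_mono) auto
  thus ?thesis by (rule that)
qed

lemma theta_phi_nonzero: "norm q < 1 \<Longrightarrow> theta_phi q \<noteq> 0"
  using euler_phi_nonzero[of "-q"] euler_phi_nonzero[of "q\<^sup>2"] norm_square_less_1[of q]
  by (simp add: theta_phi_def)

lemma theta_psi_nonzero: "norm q < 1 \<Longrightarrow> theta_psi q \<noteq> 0"
  using euler_phi_nonzero[of q] euler_phi_nonzero[of "q\<^sup>2"] norm_square_less_1[of q]
  by (simp add: theta_psi_def)

text \<open>In Shanks's identity the summand s = 0 is the partial product \<open>R n\<close>, which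
  tends to the theta product; the others carry q^(s(n+1)) and are of size O(|q|^n) uniformly in
  s.\<close>

lemma theta_phi_minus_LIMSEQ:
  assumes q: "norm q < 1"
  shows "(\<lambda>n. 1 + 2 * (\<Sum>s<n. (-1) ^ Suc s * q ^ (Suc s)\<^sup>2)) \<longlonglongrightarrow> theta_phi (-q)"
proof -
  define R where "R = (\<lambda>n. \<Prod>k<n. (1 - q ^ Suc k) / (1 + q ^ Suc k))"
  have R: "R \<longlonglongrightarrow> theta_phi (-q)"
  proof -
    \<comment> \<open>Extending by 1 - q^(k+1) turns \<open>R\<close> into a quotient of partial
      Euler products.\<close>
    have "(1 - q ^ Suc k) / (1 + q ^ Suc k) = (1 - q ^ Suc k)\<^sup>2 / (1 - (q\<^sup>2) ^ Suc k)" for k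
    proof -
      have "1 - (q\<^sup>2) ^ Suc k = (1 - q ^ Suc k) * (1 + q ^ Suc k)"
        by (simp add: algebra_simps power2_eq_square power_mult_distrib)
      thus ?thesis
        using one_minus_power_nonzero[OF q, of "Suc k"] by (simp add: power2_eq_square)
    qed
    hence "R = (\<lambda>n. (\<Prod>k<n. 1 - q ^ Suc k)\<^sup>2 / (\<Prod>k<n. 1 - (q\<^sup>2) ^ Suc k))"
      by (simp add: R_def prod_dividef prod_power_distrib)
    thus ?thesis
      using euler_phi_nonzero[OF norm_square_less_1[OF q]]
      by (auto simp: theta_phi_def simp del: power_Suc
          intro!: tendsto_intros euler_phi_LIMSEQ q norm_square_less_1)
  qed
  have "theta_phi (-q) \<noteq> 0" using q by (intro theta_phi_nonzero) simp
  from bounded_quotients[OF R this] obtain C where C: "\<And>n s. norm (R n / R s) \<le> C" by blast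
  have C0: "0 \<le> C" using C[of 0 0] norm_ge_zero order_trans by blast
  have "(\<lambda>n. \<Sum>s\<le>n. (-1) ^ s * (2 / (1 + q ^ s)) * q ^ (s * Suc n) * (R n / R s))
      \<longlonglongrightarrow> theta_phi (-q)"
  proof (rule tendsto_sum_dominated_by_first)
    show "(\<lambda>n. (-1) ^ 0 * (2 / (1 + q ^ 0)) * q ^ (0 * Suc n) * (R n / R 0)) \<longlonglongrightarrow> theta_phi (-q)"
      using R by (simp add: R_def)
  next
    fix n s :: nat assume s: "1 \<le> s" "s \<le> n"
    have qs: "norm (q ^ s) \<le> norm q"
      using power_decreasing[of 1 s "norm q"] q s by (simp add: norm_power)
    have "1 - norm q \<le> norm (1 + q ^ s)"
      using norm_triangle_ineq2[of 1 "- (q ^ s)"] qs by simp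
    hence 1: "norm (2 / (1 + q ^ s)) \<le> 2 / (1 - norm q)"
      using q unfolding norm_divide by (intro frac_le) auto
    have "1 * n \<le> s * Suc n" using s by (intro mult_mono) auto
    hence 2: "norm (q ^ (s * Suc n)) \<le> norm q ^ n"
      unfolding norm_power using q by (intro power_decreasing) auto
    have "norm ((-1) ^ s * (2 / (1 + q ^ s)) * q ^ (s * Suc n) * (R n / R s))
        = norm (2 / (1 + q ^ s)) * norm (q ^ (s * Suc n)) * norm (R n / R s)"
      by (simp only: norm_mult norm_power norm_minus_cancel norm_one power_one mult_1)
    also have "\<dots> \<le> 2 / (1 - norm q) * norm q ^ n * C"
      using q C0 by (intro mult_mono 1 2 C) auto
    finally show "norm ((-1) ^ s * (2 / (1 + q ^ s)) * q ^ (s * Suc n) * (R n / R s))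
        \<le> 2 / (1 - norm q) * C * norm q ^ n" by (simp only: mult_ac)
  qed (use q in auto)
  thus ?thesis using shanks_phi[OF q] by (simp add: R_def)
qed

lemma theta_phi_LIMSEQ:
  assumes q: "norm q < 1"
  shows "(\<lambda>n. 1 + 2 * (\<Sum>s<n. q ^ (Suc s)\<^sup>2)) \<longlonglongrightarrow> theta_phi q"
proof -
  \<comment> \<open>A number and its square have the same parity, so the signs cancel.\<close>
  have "(-1) ^ Suc s * (-q) ^ (Suc s)\<^sup>2 = q ^ (Suc s)\<^sup>2" for s
    unfolding power_minus[of q] by (cases "even s") simp_all
  thus ?thesis using theta_phi_minus_LIMSEQ[of "-q"] q by simp
qed

lemma theta_psi_LIMSEQ:
  assumes q: "norm q < 1"
  shows "(\<lambda>n. \<Sum>s<2 * n. q ^ (s * (s + 1) div 2)) \<longlonglongrightarrow> theta_psi q"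
proof -
  define P where "P = (\<lambda>n. \<Prod>k<n. (1 - q ^ (2 * k + 2)) / (1 - q ^ (2 * k + 1)))"
  have P: "P \<longlonglongrightarrow> theta_psi q"
  proof -
    \<comment> \<open>Extending by the even factors fills the denominator up to the first 2n factors
      of \<open>euler_phi q\<close>.\<close>
    have "P n = (\<Prod>k<n. 1 - (q\<^sup>2) ^ Suc k)\<^sup>2 / (\<Prod>k<2 * n. 1 - q ^ Suc k)" for n
    proof -
      have "(\<Prod>k<n. 1 - (q\<^sup>2) ^ Suc k) = (\<Prod>k<n. 1 - q ^ (2 * k + 2))"
        by (intro prod.cong) (simp_all add: power_add power_mult power2_eq_square)
      moreover have "(\<Prod>k<n. 1 - q ^ (2 * k + 2)) \<noteq> 0"
        using one_minus_power_nonzero[OF q, of "2 * _ + 2"]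
        by (subst prod_zero_iff) (auto simp del: power_Suc)
      ultimately show ?thesis
        unfolding P_def prod_even_odd prod_dividef by (simp add: power2_eq_square)
    qed
    hence P_eq: "P = (\<lambda>n. (\<Prod>k<n. 1 - (q\<^sup>2) ^ Suc k)\<^sup>2 / (\<Prod>k<2 * n. 1 - q ^ Suc k))" ..
    show ?thesis unfolding P_eq theta_psi_def
      by (intro tendsto_intros euler_phi_LIMSEQ norm_square_less_1 q euler_phi_nonzero
          LIMSEQ_double[OF euler_phi_LIMSEQ])
  qed
  from bounded_quotients[OF P theta_psi_nonzero[OF q]]
  obtain C where C: "\<And>n s. norm (P n / P s) \<le> C" by blast
  have C0: "0 \<le> C" using C[of 0 0] norm_ge_zero order_trans by blast
  \<comment> \<open>Shifted to n + 1, because \<open>shanks_psi\<close> sums over s < n while the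
    domination lemma sums over s \<le> n; the shift is undone at the end.\<close>
  have "(\<lambda>n. \<Sum>s\<le>n. q ^ (s * (2 * Suc n + 1)) * (P (Suc n) / P s)) \<longlonglongrightarrow> theta_psi q"
  proof (rule tendsto_sum_dominated_by_first)
    show "(\<lambda>n. q ^ (0 * (2 * Suc n + 1)) * (P (Suc n) / P 0)) \<longlonglongrightarrow> theta_psi q"
      using LIMSEQ_Suc[OF P] by (simp add: P_def)
  next
    fix n s :: nat assume s: "1 \<le> s" "s \<le> n"
    have "1 * n \<le> s * (2 * Suc n + 1)" using s by (intro mult_mono) auto
    hence 2: "norm (q ^ (s * (2 * Suc n + 1))) \<le> norm q ^ n"
      unfolding norm_power using q by (intro power_decreasing) auto
    have "norm (q ^ (s * (2 * Suc n + 1)) * (P (Suc n) / P s)) \<le> norm q ^ n * C"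
      unfolding norm_mult[of "q ^ _"] using q C0 by (intro mult_mono 2 C) auto
    thus "norm (q ^ (s * (2 * Suc n + 1)) * (P (Suc n) / P s)) \<le> C * norm q ^ n"
      by (simp only: mult_ac)
  qed (use q in auto)
  hence "(\<lambda>n. \<Sum>s<2 * Suc n. q ^ (s * (s + 1) div 2)) \<longlonglongrightarrow> theta_psi q"
    unfolding shanks_psi[OF q] P_def lessThan_Suc_atMost .
  thus ?thesis by (rule LIMSEQ_imp_Suc)
qed

section \<open>Dissection and product identities for the theta functions\<close>

lemma sum_even_odd:
  fixes f :: "nat \<Rightarrow> 'a :: comm_monoid_add"
  shows "(\<Sum>n<2*N. f n) = (\<Sum>n<N. f (2*n)) + (\<Sum>n<N. f (2*n+1))"
  by (induction N) (simp_all add: add_ac)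

text \<open>Even squares are 4 m^2 and odd squares are 8 s(s+1)/2 + 1, so sorting the exponents by
  parity separates the two series.\<close>

lemma theta_phi_dissect:
  assumes q: "norm q < 1"
  shows "theta_phi q = theta_phi (q ^ 4) + 2 * q * theta_psi (q ^ 8)"
proof (rule LIMSEQ_unique)
  have q4: "norm (q ^ 4) < 1" and q8: "norm (q ^ 8) < 1"
    using q by (simp_all add: norm_power power_less_one_iff)
  \<comment> \<open>Taken along 4n terms, since \<open>theta_psi_LIMSEQ\<close> speaks of partial
    sums of even length only.\<close>
  show "(\<lambda>n. 1 + 2 * (\<Sum>s<2 * (2 * n). q ^ (Suc s)\<^sup>2)) \<longlonglongrightarrow> theta_phi q"
    by (rule LIMSEQ_double[OF LIMSEQ_double[OF theta_phi_LIMSEQ[OF q]]])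
  have "(\<lambda>n. 1 + 2 * (\<Sum>s<2 * n. (q ^ 4) ^ (Suc s)\<^sup>2) +
        2 * q * (\<Sum>s<2 * n. (q ^ 8) ^ (s * (s + 1) div 2)))
      \<longlonglongrightarrow> theta_phi (q ^ 4) + 2 * q * theta_psi (q ^ 8)"
    by (intro tendsto_add tendsto_mult_left theta_psi_LIMSEQ[OF q8]
        LIMSEQ_double[OF theta_phi_LIMSEQ[OF q4]])
  moreover have "1 + 2 * (\<Sum>s<2 * n. q ^ (Suc s)\<^sup>2) =
      1 + 2 * (\<Sum>s<n. (q ^ 4) ^ (Suc s)\<^sup>2) + 2 * q * (\<Sum>s<n. (q ^ 8) ^ (s * (s + 1) div 2))" for n
  proof -
    have "q ^ (Suc (2 * s))\<^sup>2 = q * (q ^ 8) ^ (s * (s + 1) div 2)" for s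
    proof -
      have "8 * (s * (s + 1) div 2) = 4 * (s * (s + 1))"
        using dvd_mult_div_cancel[of 2 "s * (s + 1)"] by (simp del: dvd_mult_div_cancel)
      hence "(Suc (2 * s))\<^sup>2 = Suc (8 * (s * (s + 1) div 2))"
        by (simp add: power2_eq_square)
      thus ?thesis by (simp add: power_mult[symmetric])
    qed
    moreover have "q ^ (Suc (2 * s + 1))\<^sup>2 = (q ^ 4) ^ (Suc s)\<^sup>2" for s
    proof -
      have "(Suc (2 * s + 1))\<^sup>2 = 4 * (Suc s)\<^sup>2" by (simp add: power2_eq_square)
      thus ?thesis by (simp only: power_mult)
    qed
    ultimately show ?thesis
      unfolding sum_even_odd by (simp add: sum_distrib_left algebra_simps)
  qed
  ultimately show "(\<lambda>n. 1 + 2 * (\<Sum>s<2 * (2 * n). q ^ (Suc s)\<^sup>2))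
      \<longlonglongrightarrow> theta_phi (q ^ 4) + 2 * q * theta_psi (q ^ 8)"
    by (simp only:)
qed

text \<open>Extended by \<open>euler_phi q\<close>, the right-hand side contains the triple product
  of \<open>euler_phi_minus\<close>, and its value collapses the quotient to a square.\<close>

lemma theta_psi_square:
  assumes q: "norm q < 1"
  shows "(theta_psi q)\<^sup>2 = theta_phi q * theta_psi (q\<^sup>2)"
proof -
  have nz: "euler_phi q \<noteq> 0" "euler_phi (q\<^sup>2) \<noteq> 0"
    using q by (auto intro!: euler_phi_nonzero norm_power_less_1)
  have q4: "(q\<^sup>2)\<^sup>2 = q ^ 4" by (simp flip: power_mult)
  have cancel: "a\<^sup>2 / b * (c\<^sup>2 / b) = (a * d * c)\<^sup>2 / (b * d)\<^sup>2" "(b ^ 3)\<^sup>2 / (b * d)\<^sup>2 = (b\<^sup>2 / d)\<^sup>2"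
    if "d \<noteq> 0" "b \<noteq> 0" for a b c d :: complex
    using that by (simp_all add: power2_eq_square power3_eq_cube)
  show ?thesis
    unfolding theta_phi_def theta_psi_def q4 cancel(1)[OF nz] euler_phi_minus[OF q] cancel(2)[OF nz] ..
qed

text \<open>The same reduction, extending by \<open>euler_phi (q ^ 4)\<close>. It provides the
  geometric-mean half of Landen's transformation.\<close>

lemma theta_phi_times_minus:
  assumes q: "norm q < 1"
  shows "theta_phi q * theta_phi (-q) = (theta_phi (- (q\<^sup>2)))\<^sup>2"
proof -
  have nz: "euler_phi (q ^ 4) \<noteq> 0" "euler_phi (q\<^sup>2) \<noteq> 0"
    using q by (auto intro!: euler_phi_nonzero norm_power_less_1)
  have q4: "(q\<^sup>2)\<^sup>2 = q ^ 4" by (simp flip: power_mult)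
  have cancel: "a\<^sup>2 / b * (c\<^sup>2 / b) = (a * c * d)\<^sup>2 / (b * d)\<^sup>2" "(b ^ 3)\<^sup>2 / (b * d)\<^sup>2 = (b\<^sup>2 / d)\<^sup>2"
    if "d \<noteq> 0" "b \<noteq> 0" for a b c d :: complex
    using that by (simp_all add: power2_eq_square power3_eq_cube)
  show ?thesis
    unfolding theta_phi_def power2_minus minus_minus q4
      cancel(1)[OF nz] euler_phi_minus[OF q] cancel(2)[OF nz] ..
qed

section \<open>Holomorphy of the theta functions\<close>

lemma holomorphic_on_compose_unit_ball:
  assumes "g holomorphic_on ball 0 1" "f holomorphic_on A" "\<And>q. q \<in> A \<Longrightarrow> norm (f q) < 1"
  shows "(\<lambda>q. g (f q)) holomorphic_on A"
proof -
  have "f ` A \<subseteq> ball 0 1" using assms(3) by auto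
  from holomorphic_on_compose_gen[OF assms(2,1) this] show ?thesis by (simp add: comp_def)
qed

lemma theta_phi_holomorphic: "theta_phi holomorphic_on ball 0 1"
  unfolding theta_phi_def[abs_def]
  by (intro holomorphic_intros holomorphic_on_compose_unit_ball[OF euler_phi_holomorphic])
     (auto simp: euler_phi_nonzero norm_power_less_1)

lemma theta_psi_holomorphic: "theta_psi holomorphic_on ball 0 1"
  unfolding theta_psi_def[abs_def]
  by (intro holomorphic_intros holomorphic_on_compose_unit_ball[OF euler_phi_holomorphic]
      euler_phi_holomorphic)
     (auto simp: euler_phi_nonzero norm_power_less_1)

lemma isCont_compose_ball:
  fixes f g :: "complex \<Rightarrow> complex"
  assumes "f holomorphic_on ball 0 1" "isCont g z" "norm (g z) < 1"
  shows "isCont (\<lambda>q. f (g q)) z"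
proof -
  have "isCont f (g z)"
    using holomorphic_on_imp_continuous_on[OF assms(1)] assms(3)
    by (simp add: continuous_on_eq_continuous_at)
  with assms(2) show ?thesis by (rule isCont_o2)
qed

section \<open>Quadratic transformations\<close>

text \<open>Iteration gives f(q) = f(q^(2^n)), and q^(2^n) tends to 0, where f is
  continuous.\<close>

lemma eq_at_0_of_square_invariant:
  fixes f :: "complex \<Rightarrow> complex"
  assumes cont: "isCont f 0"
    and inv: "\<And>q. norm q < 1 \<Longrightarrow> f (q\<^sup>2) = f q"
    and q: "norm q < 1"
  shows "f q = f 0"
proof -
  have "f (q ^ (2 ^ n)) = f q" for n
  proof (induction n)
    case (Suc n)
    have "f ((q ^ 2 ^ n)\<^sup>2) = f (q ^ 2 ^ n)"
      using q by (intro inv norm_power_less_1) auto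
    thus ?case using Suc.IH by (simp add: mult.commute flip: power_mult)
  qed simp
  moreover have "(\<lambda>n. q ^ (2 ^ n)) \<longlonglongrightarrow> 0"
    using LIMSEQ_subseq_LIMSEQ[OF LIMSEQ_power_zero[OF q], of "\<lambda>n. 2 ^ n"]
    by (simp add: strict_mono_def comp_def)
  hence "(\<lambda>n. f (q ^ (2 ^ n))) \<longlonglongrightarrow> f 0"
    by (rule isCont_tendsto_compose[OF cont])
  ultimately show ?thesis by (simp add: LIMSEQ_const_iff)
qed

lemma euler_phi_0 [simp]: "euler_phi 0 = 1"
  by (simp add: euler_phi_def)

lemma theta_phi_0 [simp]: "theta_phi 0 = 1"
  by (simp add: theta_phi_def)

lemma theta_psi_0 [simp]: "theta_psi 0 = 1"
  by (simp add: theta_psi_def)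

lemma theta_phi_square:
  assumes q: "norm q < 1"
  shows "(theta_phi q)\<^sup>2 = (theta_phi (q\<^sup>2))\<^sup>2 + 4 * q * (theta_psi (q ^ 4))\<^sup>2"
proof -
  \<comment> \<open>The defect changes sign under $q \mapsto q^2$, so that its square is invariant.\<close>
  define U where "U = (\<lambda>q. (theta_phi q)\<^sup>2 - (theta_phi (q\<^sup>2))\<^sup>2 - 4 * q * (theta_psi (q ^ 4))\<^sup>2)"
  have "U (q\<^sup>2) = - U q" if q: "norm q < 1" for q
  proof -
    \<comment> \<open>This cancels the cross term of the squared dissection and leaves U(q) =
      phi(q^4)^2 + 4 q^2 psi(q^8)^2 - phi(q^2)^2, which is -U(q^2).\<close>
    have "(theta_psi (q ^ 4))\<^sup>2 = theta_phi (q ^ 4) * theta_psi (q ^ 8)"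
      using theta_psi_square[of "q ^ 4"] q by (simp add: norm_power_less_1 flip: power_mult)
    thus ?thesis
      using theta_phi_dissect[OF q]
      by (simp add: U_def power2_eq_square algebra_simps flip: power_mult)
         (simp add: eval_nat_numeral algebra_simps)
  qed
  hence "(U (q\<^sup>2))\<^sup>2 = (U q)\<^sup>2" if "norm q < 1" for q
    using that by simp
  moreover have "isCont (\<lambda>q. (U q)\<^sup>2) 0"
    unfolding U_def
    by (intro continuous_intros isCont_compose_ball[OF theta_phi_holomorphic]
        isCont_compose_ball[OF theta_psi_holomorphic]) auto
  ultimately have "(U q)\<^sup>2 = (U 0)\<^sup>2"
    using q by (intro eq_at_0_of_square_invariant[of "\<lambda>q. (U q)\<^sup>2"])
  thus ?thesis by (simp add: U_def algebra_simps)
qed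

lemma theta_phi_minus_square:
  assumes q: "norm q < 1"
  shows "(theta_phi (-q))\<^sup>2 = (theta_phi (q\<^sup>2))\<^sup>2 - 4 * q * (theta_psi (q ^ 4))\<^sup>2"
  using theta_phi_square[of "-q"] q by simp

text \<open>
  Both sides have the same behaviour under $q\mapsto q^2$: for the left-hand side it comes from
  differentiating Landen's transformation of \<open>r\<close>. So their quotient is invariant, hence
  equal to its value at $q = 0$.
\<close>

lemma theta_quotient_logderiv:
  assumes q: "norm q < 1"
  defines "r \<equiv> \<lambda>q. theta_phi (-q) / theta_phi q"
  shows "deriv r q / r q = - 4 * theta_psi (q\<^sup>2) ^ 4"
proof -
  have hol: "r holomorphic_on ball 0 1"
    unfolding r_def
    by (intro holomorphic_intros holomorphic_on_compose_unit_ball[OF theta_phi_holomorphic]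
        theta_phi_holomorphic) (auto simp: theta_phi_nonzero)
  have nz: "r q \<noteq> 0" if "norm q < 1" for q
    using that by (simp add: r_def theta_phi_nonzero)
  \<comment> \<open>An arithmetic-geometric mean step: phi(q)^2 and phi(-q)^2 have mean phi(q^2)^2
    and product phi(-q^2)^4.\<close>
  have landen: "(r (q\<^sup>2))\<^sup>2 * (1 + (r q)\<^sup>2) = 2 * r q" if q: "norm q < 1" for q
  proof -
    have "(theta_phi q)\<^sup>2 + (theta_phi (-q))\<^sup>2 = 2 * (theta_phi (q\<^sup>2))\<^sup>2"
      by (simp add: theta_phi_square[OF q] theta_phi_minus_square[OF q])
    hence "1 + (r q)\<^sup>2 = 2 * (theta_phi (q\<^sup>2))\<^sup>2 / (theta_phi q)\<^sup>2"
      using theta_phi_nonzero[OF q] by (simp add: r_def field_simps)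
    moreover have "(r (q\<^sup>2))\<^sup>2 = theta_phi q * theta_phi (-q) / (theta_phi (q\<^sup>2))\<^sup>2"
      by (simp add: r_def power_divide theta_phi_times_minus[OF q])
    moreover have "theta_phi (q\<^sup>2) \<noteq> 0"
      using q by (intro theta_phi_nonzero norm_power_less_1) auto
    ultimately show ?thesis
      using theta_phi_nonzero[OF q] by (simp add: r_def power2_eq_square)
  qed
  define m where "m = (\<lambda>q. deriv r q / r q)"
  \<comment> \<open>The invariance of \<open>m q / theta_psi (q\<^sup>2) ^ 4\<close>, cleared of
    denominators. The case q = 0 is separate because a factor q gets cancelled.\<close>
  have inv: "m (q\<^sup>2) * theta_psi (q\<^sup>2) ^ 4 = m q * theta_psi (q ^ 4) ^ 4" if q: "norm q < 1" for q
  proof (cases "q = 0")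
    case False
    have q2: "norm (q\<^sup>2) < 1" using q by (rule norm_square_less_1)
    have r': "(r has_field_derivative m q * r q) (at q)"
      using holomorphic_derivI[OF hol open_ball, of q] q nz[OF q] by (simp add: m_def)
    have "(r has_field_derivative m (q\<^sup>2) * r (q\<^sup>2)) (at (q\<^sup>2))"
      using holomorphic_derivI[OF hol open_ball, of "q\<^sup>2"] q2 nz[OF q2] by (simp add: m_def)
    hence r2': "((\<lambda>q. r (q\<^sup>2)) has_field_derivative m (q\<^sup>2) * r (q\<^sup>2) * (2 * q)) (at q)"
      by (rule DERIV_chain2) (auto intro!: derivative_eq_intros)
    have "((\<lambda>q. (r (q\<^sup>2))\<^sup>2 * (1 + (r q)\<^sup>2)) has_field_derivative
        4 * q * m (q\<^sup>2) * (r (q\<^sup>2))\<^sup>2 * (1 + (r q)\<^sup>2) + (r (q\<^sup>2))\<^sup>2 * (2 * (r q)\<^sup>2 * m q)) (at q)"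
      by (rule derivative_eq_intros r' r2' refl)+ (simp add: power2_eq_square algebra_simps)
    moreover have "((\<lambda>q. (r (q\<^sup>2))\<^sup>2 * (1 + (r q)\<^sup>2)) has_field_derivative 2 * (m q * r q)) (at q)"
      by (rule has_field_derivative_transform_within_open[where S = "ball 0 1"
            and f = "\<lambda>q. 2 * r q"])
         (use q in \<open>auto intro!: derivative_eq_intros r' simp: landen\<close>)
    ultimately have "4 * q * m (q\<^sup>2) * (r (q\<^sup>2))\<^sup>2 * (1 + (r q)\<^sup>2) + (r (q\<^sup>2))\<^sup>2 * (2 * (r q)\<^sup>2 * m q)
        = 2 * (m q * r q)"
      by (rule DERIV_unique)
    \<comment> \<open>Multiplying by 1 + r(q)^2 recreates the left side of \<open>landen\<close>, so
      that r(q^2) can be eliminated.\<close>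
    hence "4 * q * m (q\<^sup>2) * (1 + (r q)\<^sup>2) * ((r (q\<^sup>2))\<^sup>2 * (1 + (r q)\<^sup>2))
        + 2 * (r q)\<^sup>2 * m q * ((r (q\<^sup>2))\<^sup>2 * (1 + (r q)\<^sup>2)) = 2 * m q * r q * (1 + (r q)\<^sup>2)"
      by algebra
    hence "2 * r q * (4 * q * m (q\<^sup>2) * (1 + (r q)\<^sup>2)) = 2 * r q * (m q * (1 - (r q)\<^sup>2))"
      unfolding landen[OF q] by algebra
    hence *: "4 * q * m (q\<^sup>2) * (1 + (r q)\<^sup>2) = m q * (1 - (r q)\<^sup>2)"
      using nz[OF q] by (subst (asm) mult_cancel_left) auto
    \<comment> \<open>Back to theta functions: the sum and difference of these squares are 2
      phi(q^2)^2 and 8 q psi(q^4)^2.\<close>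
    have "4 * q * m (q\<^sup>2) * ((theta_phi q)\<^sup>2 + (theta_phi (-q))\<^sup>2)
        = m q * ((theta_phi q)\<^sup>2 - (theta_phi (-q))\<^sup>2)"
    proof -
      have "theta_phi (-q) = r q * theta_phi q" using theta_phi_nonzero[OF q] by (simp add: r_def)
      thus ?thesis using * by algebra
    qed
    hence "8 * q * (m (q\<^sup>2) * (theta_phi (q\<^sup>2))\<^sup>2) = 8 * q * (m q * (theta_psi (q ^ 4))\<^sup>2)"
      unfolding theta_phi_square[OF q] theta_phi_minus_square[OF q] by (simp add: algebra_simps)
    hence "m (q\<^sup>2) * (theta_phi (q\<^sup>2))\<^sup>2 = m q * (theta_psi (q ^ 4))\<^sup>2"
      using False by simp
    moreover have "(theta_psi (q\<^sup>2))\<^sup>2 = theta_phi (q\<^sup>2) * theta_psi (q ^ 4)"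
      using theta_psi_square[OF q2] by (simp flip: power_mult)
    ultimately show ?thesis by algebra
  qed simp
  define g where "g = (\<lambda>q. m q / theta_psi (q\<^sup>2) ^ 4)"
  have "g (q\<^sup>2) = g q" if q: "norm q < 1" for q
    using inv[OF q] theta_psi_nonzero[of "q\<^sup>2"] theta_psi_nonzero[of "q ^ 4"] norm_power_less_1[OF q]
    by (simp add: g_def field_simps flip: power_mult)
  moreover have "isCont g 0"
    unfolding g_def m_def
    by (intro continuous_intros isCont_compose_ball[OF theta_psi_holomorphic]
        isCont_compose_ball[OF hol] isCont_compose_ball[OF holomorphic_deriv[OF hol open_ball]])
       (auto simp: nz)
  ultimately have "g q = g 0" using q by (intro eq_at_0_of_square_invariant)
  \<comment> \<open>The dissection shows that \<open>theta_phi\<close> has derivative 2 at 0, so r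
    has derivative -2 - 2 there.\<close>
  moreover have "g 0 = -4"
  proof -
    define d where "d = deriv theta_phi 0"
    have d: "(theta_phi has_field_derivative d) (at 0)"
      unfolding d_def by (rule holomorphic_derivI[OF theta_phi_holomorphic]) auto
    define e where "e = deriv theta_psi 0"
    have e: "(theta_psi has_field_derivative e) (at 0)"
      unfolding e_def by (rule holomorphic_derivI[OF theta_psi_holomorphic]) auto
    have d4: "((\<lambda>q. theta_phi (q ^ 4)) has_field_derivative d * 0) (at 0)"
      by (rule DERIV_chain2) (use d in \<open>auto intro!: derivative_eq_intros\<close>)
    have e8: "((\<lambda>q. theta_psi (q ^ 8)) has_field_derivative e * 0) (at 0)"
      by (rule DERIV_chain2) (use e in \<open>auto intro!: derivative_eq_intros\<close>)
    have "((\<lambda>q. theta_phi (q ^ 4) + 2 * q * theta_psi (q ^ 8)) has_field_derivative 2) (at 0)"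
      by (rule derivative_eq_intros d4 e8 refl)+ simp
    hence phi': "(theta_phi has_field_derivative 2) (at 0)"
      by (rule has_field_derivative_transform_within_open[where S = "ball 0 1"])
         (auto simp flip: theta_phi_dissect)
    have dm: "((\<lambda>q. theta_phi (-q)) has_field_derivative 2 * (-1)) (at 0)"
      by (rule DERIV_chain2) (use phi' in \<open>auto intro!: derivative_eq_intros\<close>)
    have "(r has_field_derivative -4) (at 0)"
      unfolding r_def by (rule derivative_eq_intros phi' dm refl | simp)+
    hence "deriv r 0 = -4" by (rule DERIV_imp_deriv)
    thus ?thesis by (simp add: g_def m_def r_def)
  qed
  moreover have "deriv r q / r q = g q * theta_psi (q\<^sup>2) ^ 4"
    using theta_psi_nonzero[OF norm_square_less_1[OF q]] by (simp add: g_def m_def)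
  ultimately show ?thesis by simp
qed

section \<open>Fourth powers of the theta functions and Lambert series\<close>

lemma logderiv_mult:
  assumes "(f has_field_derivative a * f x) (at x)" "(g has_field_derivative b * g x) (at x)"
  shows "((\<lambda>x. f x * g x) has_field_derivative (a + b) * (f x * g x)) (at x)"
  by (rule derivative_eq_intros assms refl)+ (simp add: algebra_simps)

lemma logderiv_divide:
  assumes "(f has_field_derivative a * f x) (at x)" "(g has_field_derivative b * g x) (at x)"
    and "g x \<noteq> 0"
  shows "((\<lambda>x. f x / g x) has_field_derivative (a - b) * (f x / g x)) (at x)"
  by (rule derivative_eq_intros assms refl)+ (use assms(3) in \<open>simp add: field_simps\<close>)

lemma logderiv_power:
  assumes "(f has_field_derivative a * f x) (at x)"
  shows "((\<lambda>x. f x ^ n) has_field_derivative (of_nat n * a) * f x ^ n) (at x)"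
  by (rule derivative_eq_intros assms refl)+ (cases n; simp)

lemma euler_phi_power_logderiv:
  assumes q: "norm q < 1" "q \<noteq> 0" "k > 0"
  shows "((\<lambda>q. euler_phi (q ^ k)) has_field_derivative
      (- (of_nat k * lambert (q ^ k) / q)) * euler_phi (q ^ k)) (at q)"
proof -
  have qk: "norm (q ^ k) < 1" using q by (simp add: norm_power_less_1)
  have "((\<lambda>q. euler_phi (q ^ k)) has_field_derivative
      deriv euler_phi (q ^ k) * (of_nat k * q ^ (k - 1))) (at q)"
    by (rule DERIV_chain2[OF holomorphic_derivI[OF euler_phi_holomorphic]])
       (use qk in \<open>auto intro!: derivative_eq_intros\<close>)
  moreover have "d * (c * p) = - (c * (- (p * q * d / e)) / q) * e" if "e \<noteq> 0" for c d e p
    using that q(2) by simp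
  note this[OF euler_phi_nonzero[OF qk], of "deriv euler_phi (q ^ k)" "of_nat k" "q ^ (k - 1)"]
  moreover have "q ^ (k - 1) * q = q ^ k" using q(3) by (simp add: power_eq_if)
  ultimately show ?thesis
    unfolding lambert_eq_logderiv[OF qk] by (simp only:)
qed

lemma lambert_0 [simp]: "lambert 0 = 0"
  by (simp add: lambert_eq_logderiv)

text \<open>The logarithmic derivative of phi(-q) / phi(q) is computed twice: by
  \<open>theta_quotient_logderiv\<close>, and through \<open>lambert\<close> from its expression in
  Euler products.\<close>

lemma theta_psi_fourth_power:
  assumes q: "norm q < 1"
  shows "q * theta_psi (q\<^sup>2) ^ 4 = lambert q - 3 * lambert (q\<^sup>2) + 2 * lambert (q ^ 4)"
proof (cases "q = 0")
  case False
  define r where "r = (\<lambda>q. theta_phi (-q) / theta_phi q)"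
  \<comment> \<open>The exponent 1 stays explicit so that \<open>euler_phi_power_logderiv\<close>
    matches every factor.\<close>
  define w where "w = (\<lambda>q. ((euler_phi (q ^ 1))\<^sup>2 * euler_phi (q ^ 4) / euler_phi (q\<^sup>2) ^ 3)\<^sup>2)"
  have r_eq: "w q = r q" if q: "norm q < 1" for q
  proof -
    have nz: "euler_phi q \<noteq> 0" "euler_phi (q\<^sup>2) \<noteq> 0" "euler_phi (-q) \<noteq> 0" "euler_phi (q ^ 4) \<noteq> 0"
      using q by (auto intro!: euler_phi_nonzero norm_power_less_1)
    have "w q = (euler_phi q / euler_phi (-q))\<^sup>2"
      unfolding w_def euler_phi_minus[OF q, symmetric] using nz by (simp add: power2_eq_square)
    also have "\<dots> = r q" using nz by (simp add: r_def theta_phi_def power_divide)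
    finally show ?thesis .
  qed
  note E = euler_phi_power_logderiv[OF q False]
  \<comment> \<open>The logarithmic derivative of \<open>w\<close>, in the shape in which the rules
    assemble it; it is -4 / q times the wanted combination.\<close>
  let ?l = "of_nat 2 * (of_nat 2 * (- (of_nat 1 * lambert (q ^ 1) / q))
      + - (of_nat 4 * lambert (q ^ 4) / q) - of_nat 3 * (- (of_nat 2 * lambert (q ^ 2) / q)))"
  have "(w has_field_derivative ?l * w q) (at q)"
    unfolding w_def
    by (intro logderiv_power logderiv_divide logderiv_mult E)
       (use q in \<open>auto intro!: euler_phi_nonzero norm_power_less_1\<close>)
  hence "(r has_field_derivative ?l * w q) (at q)"
    by (rule has_field_derivative_transform_within_open[where S = "ball 0 1"])
       (use q r_eq in auto)
  hence "deriv r q = ?l * r q"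
    using r_eq[OF q] by (simp add: DERIV_imp_deriv)
  moreover have "r q \<noteq> 0" using q by (simp add: r_def theta_phi_nonzero)
  ultimately have "?l = - 4 * theta_psi (q\<^sup>2) ^ 4"
    using theta_quotient_logderiv[OF q] by (simp add: r_def)
  moreover have "q * ?l = - 4 * (lambert q - 3 * lambert (q\<^sup>2) + 2 * lambert (q ^ 4))"
    using False by (simp add: field_simps)
  ultimately have "- 4 * (lambert q - 3 * lambert (q\<^sup>2) + 2 * lambert (q ^ 4))
      = - 4 * (q * theta_psi (q\<^sup>2) ^ 4)" by (simp only: mult_ac)
  thus ?thesis by (subst (asm) mult_cancel_left) simp
qed simp

lemma lambert_continuous_0: "isCont lambert 0"
proof -
  have "continuous_on (ball 0 1) (\<lambda>q. - (q * deriv euler_phi q / euler_phi q))"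
    by (intro holomorphic_on_imp_continuous_on holomorphic_intros euler_phi_holomorphic)
       (auto simp: euler_phi_nonzero)
  hence "continuous_on (ball 0 1) lambert"
    by (rule continuous_on_eq) (simp add: lambert_eq_logderiv)
  thus ?thesis by (simp add: continuous_on_eq_continuous_at)
qed

text \<open>Passing from q to q^2 lowers either side by 24 q psi(q^2)^4: on the left by
  \<open>theta_psi_fourth_power\<close>, on the right by the quadratic transformations. So the
  difference is invariant, and it vanishes at 0.\<close>

lemma theta_phi_fourth_power:
  assumes q: "norm q < 1"
  shows "1 + 24 * (lambert q - 2 * lambert (q\<^sup>2)) = theta_phi q ^ 4 + 16 * q * theta_psi (q\<^sup>2) ^ 4"
proof -
  define f where "f = (\<lambda>q. 1 + 24 * (lambert q - 2 * lambert (q\<^sup>2))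
      - (theta_phi q ^ 4 + 16 * q * theta_psi (q\<^sup>2) ^ 4))"
  have "f (q\<^sup>2) = f q" if q: "norm q < 1" for q
  proof -
    have 1: "theta_phi (q\<^sup>2) ^ 4 = ((theta_phi (q\<^sup>2))\<^sup>2)\<^sup>2" "theta_phi q ^ 4 = ((theta_phi q)\<^sup>2)\<^sup>2"
      "theta_psi (q ^ 4) ^ 4 = ((theta_psi (q ^ 4))\<^sup>2)\<^sup>2"
      by (simp_all flip: power_mult)
    have 2: "(theta_psi (q\<^sup>2))\<^sup>2 = theta_phi (q\<^sup>2) * theta_psi (q ^ 4)"
      using theta_psi_square[OF norm_square_less_1[OF q]] by (simp flip: power_mult)
    hence 3: "theta_psi (q\<^sup>2) ^ 4 = (theta_phi (q\<^sup>2))\<^sup>2 * (theta_psi (q ^ 4))\<^sup>2"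
      by algebra
    have "theta_phi q ^ 4 + 16 * q * theta_psi (q\<^sup>2) ^ 4 -
        (theta_phi (q\<^sup>2) ^ 4 + 16 * q\<^sup>2 * theta_psi (q ^ 4) ^ 4) = 24 * (q * theta_psi (q\<^sup>2) ^ 4)"
      unfolding 1 3 theta_phi_square[OF q] by algebra
    thus ?thesis
      unfolding theta_psi_fourth_power[OF q] by (simp add: f_def algebra_simps flip: power_mult)
  qed
  moreover have "isCont f 0"
  proof -
    have "isCont (\<lambda>q. lambert (q\<^sup>2)) 0"
      by (rule isCont_o2[where f = "\<lambda>q. q\<^sup>2" and g = lambert]) (simp_all add: lambert_continuous_0)
    thus ?thesis
      unfolding f_def
      by (intro continuous_intros isCont_compose_ball[OF theta_phi_holomorphic]
          isCont_compose_ball[OF theta_psi_holomorphic] lambert_continuous_0) auto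
  qed
  ultimately have "f q = f 0" using q by (intro eq_at_0_of_square_invariant)
  thus ?thesis by (simp add: f_def)
qed

section \<open>Gosper's function\<close>

lemma nome_pow_of_nat: "nome_pow (of_nat k * \<tau>) 1 = nome_pow \<tau> 1 ^ k"
  by (simp add: nome_pow_def mult_ac flip: exp_of_nat_mult)

lemma norm_nome_pow_less_1: "Im \<tau> > 0 \<Longrightarrow> norm (nome_pow \<tau> 1) < 1"
  by (simp add: nome_pow_def)

text \<open>Splitting \<open>euler_phi q\<close> by parity cancels one factor of the product for psi
  and leaves the quotient that Gosper's definition squares.\<close>

lemma gosper_Pi_eq_theta_psi:
  assumes "Im \<tau> > 0"
  shows "gosper_Pi \<tau> = nome_pow \<tau> (1/4) * (theta_psi (nome_pow \<tau> 1))\<^sup>2"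
proof -
  define q where "q = nome_pow \<tau> 1"
  have q: "norm q < 1" using norm_nome_pow_less_1[OF assms] by (simp add: q_def)
  have nz: "euler_phi (q\<^sup>2) \<noteq> 0" "qpoch_inf q (q\<^sup>2) \<noteq> 0"
    using euler_phi_nonzero qpoch_inf_nonzero norm_square_less_1[OF q] q by blast+
  have "theta_psi q = euler_phi (q\<^sup>2) / qpoch_inf q (q\<^sup>2)"
    using nz by (simp add: theta_psi_def euler_phi_odd_even[OF q] power2_eq_square)
  thus ?thesis
    by (simp add: gosper_Pi_def Let_def q_def power_divide euler_phi_eq_qpoch[of "_\<^sup>2"])
qed

theorem theorem1p2:
  fixes \<tau> q :: complex
  assumes "Im \<tau> > 0"
    and "q = exp (2 * of_real pi * \<i> * \<tau>)"
  shows "(1 / (gosper_Pi (8 * \<tau>))^2 *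
      ((\<Sum>\<^sub>\<infinity>n\<in>{1::nat..}. q ^ (2*n - 1) / (1 - q ^ (2*n - 1))^2)
        - 8 * (\<Sum>\<^sub>\<infinity>n\<in>{1::nat..}. q ^ (16*n - 8) / (1 - q ^ (16*n - 8))^2))
    = (gosper_Pi (4 * \<tau>))^3 / (gosper_Pi (8 * \<tau>))^3
      + 2 * ((gosper_Pi (4 * \<tau>))^2 / (gosper_Pi (8 * \<tau>))^2)
      + 4 * (gosper_Pi (4 * \<tau>) / gosper_Pi (8 * \<tau>))
      + 4)
    \<and> (1 / (gosper_Pi (8 * \<tau>))^2 *
      (24 * ((\<Sum>\<^sub>\<infinity>n\<in>{1::nat..}. q ^ n / (1 - q ^ n)^2)
        - 8 * (\<Sum>\<^sub>\<infinity>n\<in>{1::nat..}. q ^ (8*n) / (1 - q ^ (8*n))^2)) + 7)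
    = 7 * ((gosper_Pi (4 * \<tau>))^4 / (gosper_Pi (8 * \<tau>))^4)
      + 24 * ((gosper_Pi (4 * \<tau>))^3 / (gosper_Pi (8 * \<tau>))^3)
      + 72 * ((gosper_Pi (4 * \<tau>))^2 / (gosper_Pi (8 * \<tau>))^2)
      + 96 * (gosper_Pi (4 * \<tau>) / gosper_Pi (8 * \<tau>))
      + 112)"
proof -
  have q_eq: "q = nome_pow \<tau> 1" by (simp add: assms(2) nome_pow_def)
  have q: "norm q < 1" using norm_nome_pow_less_1[OF assms(1)] by (simp add: q_eq)
  have q0: "q \<noteq> 0" by (simp add: assms(2))
  note small = norm_power_less_1[OF q]
  define X where "X = theta_phi (q ^ 4)"
  define Y where "Y = q * theta_psi (q ^ 8)"
  have Y0: "Y \<noteq> 0" using q0 small by (simp add: Y_def theta_psi_nonzero)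
  have psi4: "(theta_psi (q ^ 4))\<^sup>2 = X * theta_psi (q ^ 8)"
    using theta_psi_square[of "q ^ 4"] small by (simp add: X_def flip: power_mult)
  have psi2: "(theta_psi (q ^ 2))\<^sup>2 = theta_phi (q\<^sup>2) * theta_psi (q ^ 4)"
    using theta_psi_square[of "q ^ 2"] small by (simp flip: power_mult)
  have phi2: "(theta_phi (q\<^sup>2))\<^sup>2 = X\<^sup>2 + 4 * Y\<^sup>2"
    using theta_phi_square[of "q\<^sup>2"] small
    by (simp add: X_def Y_def power_mult_distrib flip: power_mult)
  have Pi4: "gosper_Pi (4 * \<tau>) = X * Y"
  proof -
    \<comment> \<open>At 4 \<tau> the fractional power becomes q itself, as it becomes q^2 at 8
      \<tau>.\<close>
    have "nome_pow (4 * \<tau>) (1 / 4) = q" by (simp add: q_eq nome_pow_def mult_ac)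
    moreover have "nome_pow (4 * \<tau>) 1 = q ^ 4" using nome_pow_of_nat[of 4 \<tau>] by (simp add: q_eq)
    ultimately show ?thesis
      using gosper_Pi_eq_theta_psi[of "4 * \<tau>"] assms(1) by (simp add: psi4 Y_def)
  qed
  have Pi8: "gosper_Pi (8 * \<tau>) = Y\<^sup>2"
  proof -
    have "nome_pow (8 * \<tau>) (1 / 4) = q\<^sup>2"
      by (simp add: q_eq nome_pow_def mult_ac flip: exp_double)
    moreover have "nome_pow (8 * \<tau>) 1 = q ^ 8" using nome_pow_of_nat[of 8 \<tau>] by (simp add: q_eq)
    ultimately show ?thesis
      using gosper_Pi_eq_theta_psi[of "8 * \<tau>"] assms(1) by (simp add: Y_def power_mult_distrib)
  qed
  \<comment> \<open>\<open>L1\<close>, \<open>L2\<close> and \<open>L4\<close> are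
    \<open>theta_psi_fourth_power\<close> at q, q^2 and q^4, written in X and Y.\<close>
  have L1: "lambert q - 3 * lambert (q\<^sup>2) + 2 * lambert (q ^ 4) = X ^ 3 * Y + 4 * X * Y ^ 3"
  proof -
    have "q * theta_psi (q\<^sup>2) ^ 4 = q * (theta_phi (q\<^sup>2))\<^sup>2 * (theta_psi (q ^ 4))\<^sup>2"
      using psi2 by algebra
    also have "\<dots> = X ^ 3 * Y + 4 * X * Y ^ 3"
      unfolding phi2 psi4 by (simp add: Y_def algebra_simps power2_eq_square power3_eq_cube)
    finally show ?thesis using theta_psi_fourth_power[OF q] by simp
  qed
  have L2: "lambert (q\<^sup>2) - 3 * lambert (q ^ 4) + 2 * lambert (q ^ 8) = X\<^sup>2 * Y\<^sup>2"
  proof -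
    have "q\<^sup>2 * theta_psi (q ^ 4) ^ 4 = X\<^sup>2 * Y\<^sup>2" using psi4 unfolding Y_def by algebra
    thus ?thesis using theta_psi_fourth_power[of "q\<^sup>2"] small by (simp flip: power_mult)
  qed
  have L4: "lambert (q ^ 4) - 3 * lambert (q ^ 8) + 2 * lambert (q ^ 16) = Y ^ 4"
    using theta_psi_fourth_power[of "q ^ 4"] small
    by (simp add: Y_def power_mult_distrib flip: power_mult)
  have P4: "1 + 24 * (lambert (q ^ 4) - 2 * lambert (q ^ 8)) = X ^ 4 + 16 * Y ^ 4"
    using theta_phi_fourth_power[of "q ^ 4"] small
    by (simp add: X_def Y_def power_mult_distrib flip: power_mult)
  \<comment> \<open>As 16n - 8 = 8(2n - 1), this is the odd series at q^8.\<close>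
  have "(\<Sum>\<^sub>\<infinity>n\<in>{1::nat..}. q ^ (16*n - 8) / (1 - q ^ (16*n - 8))^2) =
      (\<Sum>\<^sub>\<infinity>n\<in>{1::nat..}. (q ^ 8) ^ (2*n - 1) / (1 - (q ^ 8) ^ (2*n - 1))^2)"
    by (simp add: diff_mult_distrib2 flip: power_mult)
  also have "\<dots> = lambert (q ^ 8) - lambert (q ^ 16)"
    using lambert_odd[of "q ^ 8"] small by (simp flip: power_mult)
  \<comment> \<open>The combination is \<open>L1\<close> + 2 \<open>L2\<close> + 4
    \<open>L4\<close>, in which \<open>lambert (q ^ 4)\<close> cancels.\<close>
  finally have sum1: "(\<Sum>\<^sub>\<infinity>n\<in>{1::nat..}. q ^ (2*n - 1) / (1 - q ^ (2*n - 1))^2)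
      - 8 * (\<Sum>\<^sub>\<infinity>n\<in>{1::nat..}. q ^ (16*n - 8) / (1 - q ^ (16*n - 8))^2)
      = X ^ 3 * Y + 2 * X\<^sup>2 * Y\<^sup>2 + 4 * X * Y ^ 3 + 4 * Y ^ 4"
    unfolding lambert_odd[OF q] using L1 L2 L4 by algebra
  have "(\<Sum>\<^sub>\<infinity>n\<in>{1::nat..}. q ^ n / (1 - q ^ n)^2) = lambert q"
    "(\<Sum>\<^sub>\<infinity>n\<in>{1::nat..}. q ^ (8*n) / (1 - q ^ (8*n))^2) = lambert (q ^ 8)"
    by (simp_all add: lambert_def power_mult)
  \<comment> \<open>This is 24 \<open>L1\<close> + 72 \<open>L2\<close> + 7 \<open>P4\<close>; the 7
    removes \<open>lambert (q ^ 4)\<close> and yields the constant.\<close>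
  moreover have "24 * (lambert q - 8 * lambert (q ^ 8)) + 7
      = 7 * X ^ 4 + 24 * X ^ 3 * Y + 72 * X\<^sup>2 * Y\<^sup>2 + 96 * X * Y ^ 3 + 112 * Y ^ 4"
    using L1 L2 P4 by algebra
  ultimately have sum2: "24 * ((\<Sum>\<^sub>\<infinity>n\<in>{1::nat..}. q ^ n / (1 - q ^ n)^2)
      - 8 * (\<Sum>\<^sub>\<infinity>n\<in>{1::nat..}. q ^ (8*n) / (1 - q ^ (8*n))^2)) + 7
      = 7 * X ^ 4 + 24 * X ^ 3 * Y + 72 * X\<^sup>2 * Y\<^sup>2 + 96 * X * Y ^ 3 + 112 * Y ^ 4"
    by (simp only:)
  \<comment> \<open>The ratio of the two Gosper values. Both forms are homogeneous of degree four,
    so division by \<open>Y ^ 4\<close>, the square of \<open>gosper_Pi (8 * \<tau>)\<close>, leaves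
    polynomials in t.\<close>
  define t where "t = X / Y"
  have X: "X = t * Y" using Y0 by (simp add: t_def)
  have ratio: "(X * Y) ^ k / (Y\<^sup>2) ^ k = t ^ k" "X * Y / Y\<^sup>2 = t" for k
    using Y0 unfolding power_divide[symmetric] by (simp_all add: t_def power2_eq_square)
  have cancel: "1 / (Y\<^sup>2)\<^sup>2 * (z * Y ^ 4) = z" for z
    using Y0 by (simp flip: power_mult)
  have "X ^ 3 * Y + 2 * X\<^sup>2 * Y\<^sup>2 + 4 * X * Y ^ 3 + 4 * Y ^ 4
      = (t ^ 3 + 2 * t\<^sup>2 + 4 * t + 4) * Y ^ 4"
    unfolding X by algebra
  moreover have "7 * X ^ 4 + 24 * X ^ 3 * Y + 72 * X\<^sup>2 * Y\<^sup>2 + 96 * X * Y ^ 3 + 112 * Y ^ 4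
      = (7 * t ^ 4 + 24 * t ^ 3 + 72 * t\<^sup>2 + 96 * t + 112) * Y ^ 4"
    unfolding X by algebra
  ultimately show ?thesis
    unfolding sum1 sum2 Pi4 Pi8 ratio by (simp only: cancel)
qed

end
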